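(* Let $n\in\mathbb N$, $m=\frac{n(n+1)}2$, let $p\ge1$ be arbitrary, let $\|\cdot\|=\|\cdot\|_F$ be the Frobenius norm on $\mathcal S^n$, and let $\beta\in(0,1)$. Let $\mathbb P_{\rm true}$ be a probability distribution on $\mathcal S^n$ for which there is an exponent $a>1$ with $\mathbb E_{\mathbb P_{\rm true}}[\exp(\|\widetilde{\mathsf Q}\|_F^a)]<\infty$. Then there are positive constants $c_1,c_2$, depending only on $n$, $a$ and $\mathbb E_{\mathbb P_{\rm true}}[\exp(\|\widetilde{\mathsf Q}\|_F^a)]$, such that, with $$\theta_N(\beta):=\begin{cases}\left(\dfrac{\log(c_1\beta^{-1})}{c_2N}\right)^{1/\max\{m,2\}},&\text{if }N\ge\dfrac{\log(c_1\beta^{-1})}{c_2},\\[3mm]\left(\dfrac{\log(c_1\beta^{-1})}{c_2N}\right)^{1/a},&\text{if }N<\dfrac{\log(c_1\beta^{-1})}{c_2},\end{cases}$$ for any $\mathbf y\in\mathbb S^{n-1}$ we have $$\mathbb P_{\rm true}^N\Big[\mathbf y^\top\big(\mathbb E_{\mathbb P_{\rm true}}[\widetilde{\mathsf Q}]-\mathbb E_{\widehat{\mathbb P}_N}[\widetilde{\mathsf Q}]\big)\mathbf y\le\theta_N(\beta)\Big]\ge1-\beta .$$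
   Context: $\mathcal S^n$ is the space of real symmetric $n\times n$ matrices; $\mathbb S^{n-1}=\{\mathbf y\in\mathbb R^n:\|\mathbf y\|_2=1\}$. $\widehat{\mathsf Q}_1,\dots,\widehat{\mathsf Q}_N$ are i.i.d. samples from $\mathbb P_{\rm true}$ ($N\in\mathbb N$), $\mathbb P_{\rm true}^N$ is their joint law, $\widehat{\mathbb P}_N=\frac1N\sum_{i=1}^N\delta_{\widehat{\mathsf Q}_i}$ is the empirical distribution, so $\mathbb E_{\widehat{\mathbb P}_N}[\widetilde{\mathsf Q}]=\frac1N\sum_{i=1}^N\widehat{\mathsf Q}_i$. The constants $c_1,c_2$ do not depend on $N$, $\beta$ or $\mathbf y$. *)

theory Defs
  imports "HOL-Probability.Probability"
begin

definition sym_mats :: "(real ^ 'n ^ 'n) set" where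
  "sym_mats = {A. transpose A = A}"

(* Measures with the sets of sym_borel live on the space of symmetric matrices itself. *)
definition sym_borel :: "(real ^ 'n ^ 'n) measure" where
  "sym_borel = restrict_space borel sym_mats"

(* The library norm of real ^ 'n ^ 'n is the Frobenius norm, not the operator norm. *)
lemma norm_eq_frobenius:
  fixes A :: "real ^ 'n ^ 'n"
  shows "norm A = sqrt (\<Sum>i\<in>UNIV. \<Sum>j\<in>UNIV. (A $ i $ j)\<^sup>2)"
  by (simp add: norm_vec_def L2_set_def sum_nonneg)

(* Pushing the uniform distribution on the indices forward counts repeated samples with multiplicity. *)
definition empirical_measure :: "nat \<Rightarrow> (nat \<Rightarrow> real ^ 'n ^ 'n) \<Rightarrow> (real ^ 'n ^ 'n) measure" where
  "empirical_measure N Q = distr (uniform_count_measure {..<N}) sym_borel Q"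

lemma space_sym_borel: "space sym_borel = sym_mats"
  by (simp add: sym_borel_def space_restrict_space)

lemma prob_space_empirical_measure:
  assumes "N \<ge> 1" "\<And>i. i < N \<Longrightarrow> Q i \<in> sym_mats"
  shows "prob_space (empirical_measure N Q)"
  unfolding empirical_measure_def
proof (rule prob_space.prob_space_distr)
  show "prob_space (uniform_count_measure {..<N})"
    using assms(1) by (intro prob_space_uniform_count_measure) (auto simp: lessThan_empty_iff)
  show "Q \<in> uniform_count_measure {..<N} \<rightarrow>\<^sub>M sym_borel"
    using assms(2) by (auto simp: measurable_def sets_uniform_count_measure
        space_uniform_count_measure space_sym_borel)
qed

lemma expectation_empirical_measure:
  assumes "\<And>i. i < N \<Longrightarrow> Q i \<in> sym_mats"
  shows "(\<integral>X. X \<partial>empirical_measure N Q) = (1 / real N) *\<^sub>R (\<Sum>i<N. Q i)"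
proof -
  have "(\<integral>X. X \<partial>empirical_measure N Q) = (\<integral>i. Q i \<partial>uniform_count_measure {..<N})"
    unfolding empirical_measure_def
  proof (rule integral_distr)
    show "Q \<in> uniform_count_measure {..<N} \<rightarrow>\<^sub>M sym_borel"
      using assms by (auto simp: measurable_def sets_uniform_count_measure
          space_uniform_count_measure space_sym_borel)
    show "(\<lambda>X. X) \<in> borel_measurable sym_borel"
      unfolding sym_borel_def by (intro measurable_restrict_space1) simp
  qed
  also have "\<dots> = (1 / real N) *\<^sub>R (\<Sum>i<N. Q i)"
    unfolding uniform_count_measure_def
    by (subst lebesgue_integral_point_measure_finite) (auto simp: scaleR_sum_right)
  finally show ?thesis .
qed

(* The logarithm is positive as soon as c1 > beta, in which case both bases are positive reals
   and powr is the usual real power. *)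
definition theta :: "nat \<Rightarrow> real \<Rightarrow> real \<Rightarrow> real \<Rightarrow> nat \<Rightarrow> real \<Rightarrow> real" where
  "theta m a c\<^sub>1 c\<^sub>2 N \<beta> =
     (if real N \<ge> ln (c\<^sub>1 / \<beta>) / c\<^sub>2
      then (ln (c\<^sub>1 / \<beta>) / (c\<^sub>2 * real N)) powr (1 / real (max m 2))
      else (ln (c\<^sub>1 / \<beta>) / (c\<^sub>2 * real N)) powr (1 / a))"

end

theory Submission
  imports Defs
begin

text \<open>
  For a unit vector \<open>y\<close> the map \<open>Q \<mapsto> y\<^sup>T Q y\<close> is the Frobenius inner product with the
  rank-one matrix \<open>y y\<^sup>T\<close> of norm 1. It turns the samples into i.i.d. real variables
  \<open>f(Q)\<close> with \<open>\<bar>f(Q)\<bar> \<le> \<parallel>Q\<parallel>\<close>, so that \<open>E exp (\<bar>f\<bar>\<^sup>a) \<le> A\<close> uniformly in \<open>y\<close>. The claim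
  is therefore a one-dimensional bound on how far an empirical mean falls below the
  expectation. In dimension one the exponent \<open>1 / 2\<close> is available for small radii, and
  \<open>1 / max m 2\<close> is no harder, because a smaller exponent only enlarges the radius while its
  base is at most 1.

  Everything comes from the exponential Markov inequality for product measures
  (\<open>chernoff_iid\<close>), applied in two regimes. For a deviation \<open>\<epsilon> \<le> 1\<close> it is applied to
  \<open>l (E f - f)\<close> with \<open>0 \<le> l \<le> 1\<close>, whose moment generating function is at most
  \<open>exp (l\<^sup>2 B)\<close>; optimising \<open>l\<close> gives the Gaussian rate \<open>\<epsilon>\<^sup>2 / (4 B)\<close>. This argument
  cannot produce the rate \<open>\<epsilon>\<^sup>a\<close> needed for large \<open>\<epsilon>\<close>. There centring
  costs only a constant factor, since \<open>\<bar>E f\<bar> \<le> A\<close>: if \<open>\<epsilon> \<ge> 4 A\<close>, a deviation of \<open>\<epsilon>\<close>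
  forces the mean of \<open>\<bar>f\<bar>\<close> to be at least \<open>\<epsilon> / 2\<close>, hence by convexity of \<open>x\<^sup>a\<close> the mean of
  \<open>\<bar>f\<bar>\<^sup>a\<close> to be at least \<open>(\<epsilon> / 2)\<^sup>a\<close>, and the Markov inequality applies to \<open>\<bar>f\<bar>\<^sup>a\<close>
  itself. Between 1 and \<open>4 A\<close> the bound at \<open>\<epsilon> = 1\<close> is good enough, because \<open>\<epsilon>\<^sup>a\<close> is bounded
  there. With \<open>c\<^sub>1 = 1\<close> and \<open>c\<^sub>2 = 1 / (4 B (4 A)\<^sup>a)\<close> both regimes give failure probability at
  most \<open>\<beta>\<close>.
\<close>

section \<open>Elementary inequalities\<close>

text \<open>
  The second-order Taylor remainder of \<open>exp (l z)\<close> carries the factor \<open>l\<^sup>2\<close> times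
  \<open>z\<^sup>2 / 2 \<sqdot> exp \<bar>z\<bar>\<close>, and \<open>z\<^sup>2 / 2 \<le> exp \<bar>z\<bar>\<close>. Keeping the linear term matters: it vanishes
  under the expectation when \<open>z\<close> is centred.
\<close>
lemma exp_le_quadratic_remainder:
  fixes l z :: real
  assumes "0 \<le> l" "l \<le> 1"
  shows "exp (l * z) \<le> 1 + l * z + l\<^sup>2 * exp (2 * \<bar>z\<bar>)"
proof -
  obtain t where t: "\<bar>t\<bar> \<le> \<bar>l * z\<bar>"
      "exp (l * z) = (\<Sum>k<2. (l * z) ^ k / fact k) + exp t / fact 2 * (l * z) ^ 2"
    using Maclaurin_exp_le by blast
  have "\<bar>l * z\<bar> \<le> \<bar>z\<bar>"
    using assms by (simp add: abs_mult mult_left_le_one_le)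
  then have et: "exp t \<le> exp \<bar>z\<bar>"
    using t(1) by simp
  have z2: "z\<^sup>2 / 2 \<le> exp \<bar>z\<bar>"
    using exp_lower_Taylor_quadratic[of "\<bar>z\<bar>"] by simp
  have "exp t / 2 * (l * z)\<^sup>2 = l\<^sup>2 * (exp t * (z\<^sup>2 / 2))"
    by (simp add: power_mult_distrib)
  also have "\<dots> \<le> l\<^sup>2 * (exp \<bar>z\<bar> * exp \<bar>z\<bar>)"
    by (intro mult_left_mono mult_mono et z2) auto
  also have "\<dots> = l\<^sup>2 * exp (2 * \<bar>z\<bar>)"
    by (simp flip: exp_add)
  finally show ?thesis
    using t(2) by (simp add: numeral_2_eq_2)
qed

lemma le_exp_powr:
  fixes x a :: real
  assumes "a > 1" "x \<ge> 0"
  shows "x \<le> exp (x powr a)"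
proof (cases "x \<le> 1")
  case True
  then show ?thesis by (smt (verit) one_le_exp_iff powr_ge_zero)
next
  case False
  then have "x powr 1 \<le> x powr a"
    using assms by (intro powr_mono) auto
  then show ?thesis
    using False assms exp_ge_add_one_self[of "x powr a"] by (smt (verit) powr_one)
qed

text \<open>
  Since \<open>a > 1\<close>, the power \<open>x\<^sup>a = x\<^sup>a\<^sup>-\<^sup>1 x\<close> beats \<open>2 x\<close> as soon as \<open>x\<^sup>a\<^sup>-\<^sup>1 \<ge> 2\<close>; below that
  threshold \<open>2 x\<close> is bounded by the additive constant. This is what makes
  \<open>exp (2 \<bar>f\<bar>)\<close> integrable, with a bound that depends only on \<open>a\<close> and the given moment.
\<close>
lemma two_times_le_powr_add:
  fixes x a :: real
  assumes "a > 1" "x \<ge> 0"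
  shows "2 * x \<le> x powr a + 2 powr (a / (a - 1))"
proof (cases "x \<le> 2 powr (1 / (a - 1))")
  case True
  have "2 * x \<le> 2 powr 1 * 2 powr (1 / (a - 1))"
    using True by simp
  also have "\<dots> = 2 powr (1 + 1 / (a - 1))"
    by (rule powr_add[symmetric])
  also have "1 + 1 / (a - 1) = a / (a - 1)"
    using assms by (simp add: field_simps)
  finally show ?thesis by (smt (verit) powr_ge_zero)
next
  case False
  then have x: "x > 0" by (smt (verit) powr_ge_zero)
  have "2 = (2 powr (1 / (a - 1))) powr (a - 1)"
    using assms by (simp add: powr_powr)
  also have "\<dots> \<le> x powr (a - 1)"
    using False assms by (intro powr_mono2) auto
  finally have "2 * x \<le> x powr (a - 1) * x powr 1"
    using x by simp
  also have "\<dots> = x powr a"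
    by (simp only: powr_add[symmetric] diff_add_cancel)
  finally show ?thesis by (smt (verit) powr_ge_zero)
qed

text \<open>
  Convexity is wanted at 0 as well, where the second derivative may blow up: an empirical
  mean of absolute values can have vanishing summands.
\<close>
lemma convex_on_powr_nonneg:
  assumes "p \<ge> 1"
  shows "convex_on {0::real..} (\<lambda>x. x powr p)"
proof (rule convex_on_linorderI)
  fix t x y :: real
  assume t: "0 < t" "t < 1" and xy: "x \<in> {0..}" "y \<in> {0..}" "x < y"
  show "((1 - t) *\<^sub>R x + t *\<^sub>R y) powr p \<le> (1 - t) * x powr p + t * y powr p"
  proof (cases "x = 0")
    case True
    have "t powr p \<le> t powr 1"
      using t assms by (intro powr_mono') auto
    then have "t powr p * y powr p \<le> t * y powr p"
      using t by (intro mult_right_mono) auto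
    then show ?thesis
      using True t xy assms by (simp add: powr_mult)
  next
    case False
    then show ?thesis
      using t xy by (intro convex_onD[OF powr_convex[OF assms]]) auto
  qed
qed simp

lemma powr_mean_le:
  fixes x :: "nat \<Rightarrow> real"
  assumes "a \<ge> 1" "N \<ge> 1" "\<And>i. x i \<ge> 0"
  shows "((\<Sum>i<N. x i) / real N) powr a \<le> (\<Sum>i<N. x i powr a) / real N"
proof -
  have "((\<Sum>i<N. (1 / real N) *\<^sub>R x i)) powr a \<le> (\<Sum>i<N. (1 / real N) * (x i powr a))"
    by (rule convex_on_sum[where f = "\<lambda>x. x powr a" and C = "{0..}"])
      (use assms in \<open>auto intro!: convex_on_powr_nonneg simp: lessThan_empty_iff\<close>)
  then show ?thesis
    by (simp add: sum_divide_distrib)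
qed

section \<open>The exponential Markov inequality for independent samples\<close>

text \<open>
  Independence enters only here: the exponential of a sum of functions of the separate
  coordinates is a product, whose integral over the product measure factorises.
\<close>
lemma chernoff_iid:
  fixes g :: "'b \<Rightarrow> real"
  assumes "prob_space P" and int: "integrable P (\<lambda>x. exp (g x))"
    and le: "(\<integral>x. exp (g x) \<partial>P) \<le> exp b" and [measurable]: "g \<in> borel_measurable P"
  shows "measure (PiM {..<N} (\<lambda>_. P)) {\<omega> \<in> space (PiM {..<N} (\<lambda>_. P)). (\<Sum>i<N. g (\<omega> i)) \<ge> s}
    \<le> exp (real N * b - s)"
proof -
  interpret P: prob_space P by fact
  interpret PP: product_prob_space "\<lambda>_. P" "{..<N}" by unfold_locales
  let ?M = "PiM {..<N} (\<lambda>_. P)"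
  have fin: "integrable ?M (\<lambda>\<omega>. \<Prod>i<N. exp (g (\<omega> i)))"
    by (rule PP.product_integrable_prod) (use int in auto)
  have "measure ?M {\<omega> \<in> space ?M. (\<Sum>i<N. g (\<omega> i)) \<ge> s}
      = measure ?M {\<omega> \<in> space ?M. (\<Prod>i<N. exp (g (\<omega> i))) \<ge> exp s}"
    by (simp flip: exp_sum)
  also have "\<dots> \<le> (\<integral>\<omega>. (\<Prod>i<N. exp (g (\<omega> i))) \<partial>?M) / exp s"
    by (rule integral_Markov_inequality_measure[OF fin, where A = "{}"]) (auto intro!: prod_nonneg)
  also have "(\<integral>\<omega>. (\<Prod>i<N. exp (g (\<omega> i))) \<partial>?M) = (\<integral>x. exp (g x) \<partial>P) ^ N"
    by (subst PP.product_integral_prod) (use int in auto)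
  also have "\<dots> / exp s \<le> exp b ^ N / exp s"
    by (intro divide_right_mono power_mono le) auto
  also have "\<dots> = exp (real N * b - s)"
    by (simp add: exp_diff exp_of_nat_mult)
  finally show ?thesis .
qed

section \<open>Empirical means of variables with a finite exponential moment of order \<open>a\<close>\<close>

text \<open>
  A bound on \<open>E exp (2 \<bar>E f - f\<bar>)\<close>: the summand \<open>2 A\<close> pays for the centring and the
  power of 2 for comparing \<open>2 \<bar>f\<bar>\<close> with \<open>\<bar>f\<bar>\<^sup>a\<close>.
\<close>
definition mgf_const :: "real \<Rightarrow> real \<Rightarrow> real" where
  "mgf_const a A = A * exp (2 * A + 2 powr (a / (a - 1)))"

locale weibull_tail = prob_space P for P :: "'b measure" +
  fixes f :: "'b \<Rightarrow> real" and a A :: real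
  assumes a: "a > 1"
    and meas [measurable]: "f \<in> borel_measurable P"
    and int: "integrable P (\<lambda>x. exp (\<bar>f x\<bar> powr a))"
    and le: "expectation (\<lambda>x. exp (\<bar>f x\<bar> powr a)) \<le> A"
begin

abbreviation B :: real where "B \<equiv> mgf_const a A"

definition lower_deviation :: "nat \<Rightarrow> real \<Rightarrow> real" where
  "lower_deviation N \<epsilon> = measure (PiM {..<N} (\<lambda>_. P))
     {\<omega> \<in> space (PiM {..<N} (\<lambda>_. P)). (\<Sum>i<N. expectation f - f (\<omega> i)) \<ge> real N * \<epsilon>}"

lemma A_ge_1: "A \<ge> 1"
proof -
  have "1 = expectation (\<lambda>_. 1::real)" by (simp add: prob_space)
  also have "\<dots> \<le> expectation (\<lambda>x. exp (\<bar>f x\<bar> powr a))"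
    using int by (intro integral_mono) auto
  finally show ?thesis using le by simp
qed

lemma B_ge_1: "B \<ge> 1"
proof -
  have "1 * 1 \<le> A * exp (2 * A + 2 powr (a / (a - 1)))"
    by (intro mult_mono) (use A_ge_1 in auto)
  then show ?thesis by (simp add: mgf_const_def)
qed

lemma integrable_f: "integrable P f"
  by (rule Bochner_Integration.integrable_bound[OF int]) (use le_exp_powr[OF a] in auto)

lemma abs_expectation_le: "\<bar>expectation f\<bar> \<le> A"
proof -
  have "\<bar>expectation f\<bar> \<le> expectation (\<lambda>x. \<bar>f x\<bar>)"
    by (rule integral_abs_bound)
  also have "\<dots> \<le> expectation (\<lambda>x. exp (\<bar>f x\<bar> powr a))"
    using integrable_f int le_exp_powr[OF a] by (intro integral_mono) auto
  finally show ?thesis using le by simp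
qed

lemma exp_centred_le:
  "exp (2 * \<bar>expectation f - f x\<bar>) \<le> exp (2 * A + 2 powr (a / (a - 1))) * exp (\<bar>f x\<bar> powr a)"
proof -
  have "2 * \<bar>expectation f - f x\<bar> \<le> 2 * A + 2 * \<bar>f x\<bar>"
    using abs_expectation_le abs_triangle_ineq4[of "expectation f" "f x"] by (simp add: algebra_simps)
  also have "\<dots> \<le> 2 * A + 2 powr (a / (a - 1)) + \<bar>f x\<bar> powr a"
    using two_times_le_powr_add[OF a, of "\<bar>f x\<bar>"] by simp
  finally show ?thesis by (simp flip: exp_add)
qed

text \<open>
  In the quadratic expansion the linear term has expectation 0, so the exponent grows only
  like \<open>l\<^sup>2\<close>. The restriction to \<open>l \<le> 1\<close> is the price for a constant independent of \<open>l\<close>.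
\<close>
lemma
  assumes l: "0 \<le> l" "l \<le> 1"
  shows integrable_mgf: "integrable P (\<lambda>x. exp (l * (expectation f - f x)))"
    and mgf_le: "expectation (\<lambda>x. exp (l * (expectation f - f x))) \<le> exp (l\<^sup>2 * B)"
proof -
  define Z where "Z x = expectation f - f x" for x
  define C where "C = exp (2 * A + 2 powr (a / (a - 1)))"
  have [measurable]: "Z \<in> borel_measurable P" unfolding Z_def by measurable
  have intZ: "integrable P Z" unfolding Z_def using integrable_f by auto
  have EZ: "expectation Z = 0" unfolding Z_def using integrable_f by (simp add: prob_space)
  have pt: "exp (l * Z x) \<le> 1 + l * Z x + l\<^sup>2 * (C * exp (\<bar>f x\<bar> powr a))" for x
  proof -
    have "l\<^sup>2 * exp (2 * \<bar>Z x\<bar>) \<le> l\<^sup>2 * (C * exp (\<bar>f x\<bar> powr a))"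
      unfolding Z_def C_def by (intro mult_left_mono exp_centred_le) auto
    then show ?thesis using exp_le_quadratic_remainder[OF l, of "Z x"] by linarith
  qed
  have intR: "integrable P (\<lambda>x. 1 + l * Z x + l\<^sup>2 * (C * exp (\<bar>f x\<bar> powr a)))"
    using intZ int by auto
  have intL: "integrable P (\<lambda>x. exp (l * Z x))"
    by (rule Bochner_Integration.integrable_bound[OF intR]) (use pt in \<open>auto intro: order_trans[OF _ abs_ge_self]\<close>)
  then show "integrable P (\<lambda>x. exp (l * (expectation f - f x)))"
    by (simp add: Z_def)
  have "expectation (\<lambda>x. exp (l * Z x))
      \<le> expectation (\<lambda>x. 1 + l * Z x + l\<^sup>2 * (C * exp (\<bar>f x\<bar> powr a)))"
    by (intro integral_mono intL intR pt)
  also have "\<dots> = 1 + l\<^sup>2 * (C * expectation (\<lambda>x. exp (\<bar>f x\<bar> powr a)))"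
    using intZ int by (simp add: EZ prob_space)
  also have "\<dots> \<le> 1 + l\<^sup>2 * (C * A)"
    using le by (intro add_left_mono mult_left_mono) (auto simp: C_def)
  also have "\<dots> = 1 + l\<^sup>2 * B" by (simp add: mgf_const_def C_def mult.commute)
  also have "\<dots> \<le> exp (l\<^sup>2 * B)" by (rule exp_ge_add_one_self)
  finally show "expectation (\<lambda>x. exp (l * (expectation f - f x))) \<le> exp (l\<^sup>2 * B)"
    by (simp add: Z_def)
qed

lemma lower_deviation_gaussian:
  assumes \<epsilon>: "0 < \<epsilon>" "\<epsilon> \<le> 1"
  shows "lower_deviation N \<epsilon> \<le> exp (- (real N * \<epsilon>\<^sup>2 / (4 * B)))"
proof -
  \<comment> \<open>the minimiser of \<open>l\<^sup>2 B - l \<epsilon>\<close>; it is at most 1 because \<open>\<epsilon> \<le> 1 \<le> B\<close>\<close>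
  define l where "l = \<epsilon> / (2 * B)"
  have l: "0 < l" "l \<le> 1" using \<epsilon> B_ge_1 by (auto simp: l_def field_simps)
  have "lower_deviation N \<epsilon> = measure (PiM {..<N} (\<lambda>_. P))
     {\<omega> \<in> space (PiM {..<N} (\<lambda>_. P)). (\<Sum>i<N. l * (expectation f - f (\<omega> i))) \<ge> l * (real N * \<epsilon>)}"
    using l by (simp only: lower_deviation_def mult_le_cancel_left_pos flip: sum_distrib_left)
  also have "\<dots> \<le> exp (real N * (l\<^sup>2 * B) - l * (real N * \<epsilon>))"
    using l by (intro chernoff_iid integrable_mgf mgf_le prob_space_axioms) auto
  also have "real N * (l\<^sup>2 * B) - l * (real N * \<epsilon>) = - (real N * \<epsilon>\<^sup>2 / (4 * B))"
    using B_ge_1 by (simp add: l_def power2_eq_square field_simps)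
  finally show ?thesis .
qed

lemma lower_deviation_antimono:
  assumes "\<epsilon> \<le> \<delta>"
  shows "lower_deviation N \<delta> \<le> lower_deviation N \<epsilon>"
proof -
  interpret PP: prob_space "PiM {..<N} (\<lambda>_. P)"
    by (intro prob_space_PiM prob_space_axioms)
  have "real N * \<epsilon> \<le> real N * \<delta>" using assms by (simp add: mult_left_mono)
  then show ?thesis unfolding lower_deviation_def
    by (intro PP.finite_measure_mono) auto
qed

text \<open>
  For \<open>\<epsilon> \<ge> 4 A\<close> half of \<open>\<epsilon>\<close> absorbs the expectation, and half of the resulting exponent
  \<open>(\<epsilon> / 2)\<^sup>a\<close> absorbs the factor \<open>A\<^sup>N\<close> that the Markov inequality costs.
\<close>
lemma lower_deviation_large:
  assumes \<epsilon>: "4 * A \<le> \<epsilon>" and N: "N \<ge> 1"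
  shows "lower_deviation N \<epsilon> \<le> exp (- (real N * (\<epsilon> powr a / (2 * 2 powr a))))"
proof -
  interpret PP: prob_space "PiM {..<N} (\<lambda>_. P)"
    by (intro prob_space_PiM prob_space_axioms)
  define r where "r = \<epsilon> / 2"
  have r: "2 * A \<le> r" "1 \<le> r" using \<epsilon> A_ge_1 by (auto simp: r_def)
  have "lower_deviation N \<epsilon> \<le> measure (PiM {..<N} (\<lambda>_. P))
     {\<omega> \<in> space (PiM {..<N} (\<lambda>_. P)). (\<Sum>i<N. \<bar>f (\<omega> i)\<bar> powr a) \<ge> real N * r powr a}"
    unfolding lower_deviation_def
  proof (rule PP.finite_measure_mono, clarify)
    fix \<omega> assume "real N * \<epsilon> \<le> (\<Sum>i<N. expectation f - f (\<omega> i))"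
    also have "\<dots> \<le> (\<Sum>i<N. A + \<bar>f (\<omega> i)\<bar>)"
      using abs_expectation_le by (intro sum_mono) (smt (verit))
    finally have "real N * (\<epsilon> - A) \<le> (\<Sum>i<N. \<bar>f (\<omega> i)\<bar>)"
      by (simp add: sum.distrib algebra_simps)
    moreover have "real N * r \<le> real N * (\<epsilon> - A)"
      using \<epsilon> A_ge_1 by (intro mult_left_mono) (auto simp: r_def)
    ultimately have "r \<le> (\<Sum>i<N. \<bar>f (\<omega> i)\<bar>) / real N"
      using N by (simp add: field_simps)
    then have "r powr a \<le> ((\<Sum>i<N. \<bar>f (\<omega> i)\<bar>) / real N) powr a"
      using r a by (intro powr_mono2) auto
    also have "\<dots> \<le> (\<Sum>i<N. \<bar>f (\<omega> i)\<bar> powr a) / real N"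
      using a N by (intro powr_mean_le) auto
    finally show "real N * r powr a \<le> (\<Sum>i<N. \<bar>f (\<omega> i)\<bar> powr a)"
      using N by (simp add: field_simps)
  qed auto
  also have "\<dots> \<le> exp (real N * ln A - real N * r powr a)"
    using le A_ge_1 by (intro chernoff_iid int prob_space_axioms) auto
  also have "\<dots> \<le> exp (- (real N * (\<epsilon> powr a / (2 * 2 powr a))))"
  proof -
    have "r powr 1 \<le> r powr a" using r a by (intro powr_mono) auto
    moreover have "ln A \<le> A" using A_ge_1 ln_bound by simp
    ultimately have "ln A \<le> r powr a / 2" using r by simp
    then have "real N * ln A \<le> real N * (r powr a / 2)" by (intro mult_left_mono) auto
    moreover have "\<epsilon> powr a / (2 * 2 powr a) = r powr a / 2"
      using \<epsilon> A_ge_1 by (simp add: r_def powr_divide)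
    ultimately show ?thesis by (simp only: exp_le_cancel_iff)
  qed
  finally show ?thesis .
qed

text \<open>
  The constant is chosen so that \<open>\<epsilon>\<^sup>a / (4 B (4 A)\<^sup>a) \<le> 1 / (4 B)\<close> on \<open>[1, 4 A]\<close>, where only
  the Gaussian bound at deviation 1 is at hand; for \<open>\<epsilon> > 4 A\<close> it is weaker than the bound
  already obtained.
\<close>
lemma lower_deviation_powr:
  assumes \<epsilon>: "1 \<le> \<epsilon>" and N: "N \<ge> 1"
  shows "lower_deviation N \<epsilon> \<le> exp (- (real N * (\<epsilon> powr a / (4 * B * (4 * A) powr a))))"
proof (cases "\<epsilon> \<le> 4 * A")
  case True
  have "lower_deviation N \<epsilon> \<le> exp (- (real N * 1\<^sup>2 / (4 * B)))"
    using lower_deviation_antimono[OF \<epsilon>] lower_deviation_gaussian[of 1 N] by (auto intro: order_trans)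
  also have "\<dots> \<le> exp (- (real N * (\<epsilon> powr a / (4 * B * (4 * A) powr a))))"
  proof -
    have "\<epsilon> powr a \<le> (4 * A) powr a"
      using True \<epsilon> a by (intro powr_mono2) auto
    then have "\<epsilon> powr a / (4 * B * (4 * A) powr a) \<le> (4 * A) powr a / (4 * B * (4 * A) powr a)"
      using B_ge_1 by (intro divide_right_mono) auto
    also have "\<dots> = 1 / (4 * B)" using A_ge_1 by simp
    finally have "real N * (\<epsilon> powr a / (4 * B * (4 * A) powr a)) \<le> real N * (1 / (4 * B))"
      by (intro mult_left_mono) auto
    then show ?thesis by simp
  qed
  finally show ?thesis .
next
  case False
  then have "lower_deviation N \<epsilon> \<le> exp (- (real N * (\<epsilon> powr a / (2 * 2 powr a))))"
    using N by (intro lower_deviation_large) auto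
  also have "\<dots> \<le> exp (- (real N * (\<epsilon> powr a / (4 * B * (4 * A) powr a))))"
  proof -
    have "2 powr a \<le> (4 * A) powr a" using A_ge_1 a by (intro powr_mono2) auto
    then have "2 * 2 powr a \<le> 4 * B * (4 * A) powr a"
      using B_ge_1 by (intro mult_mono) auto
    then have "\<epsilon> powr a / (4 * B * (4 * A) powr a) \<le> \<epsilon> powr a / (2 * 2 powr a)"
      by (intro divide_left_mono) (use A_ge_1 B_ge_1 in \<open>auto intro!: mult_pos_pos\<close>)
    then have "real N * (\<epsilon> powr a / (4 * B * (4 * A) powr a)) \<le> real N * (\<epsilon> powr a / (2 * 2 powr a))"
      by (rule mult_left_mono) simp
    then show ?thesis by (simp only: exp_le_cancel_iff neg_le_iff_le)
  qed
  finally show ?thesis .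
qed

text \<open>
  The base \<open>t\<close> of the radius satisfies \<open>N c t = ln (1 / \<beta>)\<close>, so
  \<open>exp (- N c t)\<close> is exactly \<open>\<beta>\<close>. For \<open>t \<le> 1\<close> the radius is at least \<open>\<surd>t\<close> and the Gaussian
  bound applies; for \<open>t > 1\<close> its \<open>a\<close>-th power is \<open>t\<close>.
\<close>
lemma lower_deviation_theta:
  assumes N: "N \<ge> 1" and \<beta>: "0 < \<beta>" "\<beta> < 1"
  shows "lower_deviation N (theta m a 1 (1 / (4 * B * (4 * A) powr a)) N \<beta>) \<le> \<beta>"
proof -
  define c where "c = 1 / (4 * B * (4 * A) powr a)"
  define L where "L = ln (1 / \<beta>)"
  define t where "t = L / (c * real N)"
  have c: "c > 0" using A_ge_1 B_ge_1 by (simp add: c_def)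
  have L: "L > 0" using \<beta> by (simp add: L_def)
  have t: "t > 0" using c L N by (simp add: t_def)
  have tL: "real N * (c * t) = L" using c N by (simp add: t_def)
  have \<beta>L: "exp (- L) = \<beta>" using \<beta> by (simp add: L_def ln_div)
  have cond: "real N \<ge> L / c \<longleftrightarrow> t \<le> 1" using c N by (simp add: t_def field_simps)
  have "lower_deviation N (theta m a 1 c N \<beta>) \<le> \<beta>"
  proof (cases "t \<le> 1")
    case True
    have th: "theta m a 1 c N \<beta> = t powr (1 / real (max m 2))"
      using True cond by (simp add: theta_def t_def L_def)
    have "t powr (1 / 2) \<le> t powr (1 / real (max m 2))"
      using True t by (intro powr_mono') (auto simp: field_simps)
    then have sq: "sqrt t \<le> theta m a 1 c N \<beta>"
      using t by (simp add: th powr_half_sqrt)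
    have "lower_deviation N (theta m a 1 c N \<beta>) \<le> lower_deviation N (sqrt t)"
      by (rule lower_deviation_antimono[OF sq])
    also have "\<dots> \<le> exp (- (real N * (sqrt t)\<^sup>2 / (4 * B)))"
      using t True by (intro lower_deviation_gaussian) auto
    also have "\<dots> \<le> exp (- L)"
    proof -
      have "1 \<le> (4 * A) powr a" using A_ge_1 a by (intro ge_one_powr_ge_zero) auto
      then have "4 * B * 1 \<le> 4 * B * (4 * A) powr a" using B_ge_1 by (intro mult_left_mono) auto
      then have "c \<le> 1 / (4 * B)"
        unfolding c_def using B_ge_1 A_ge_1 by (intro divide_left_mono) auto
      then have "real N * (c * t) \<le> real N * (1 / (4 * B) * t)"
        using t by (intro mult_left_mono mult_right_mono) auto
      then show ?thesis using t tL by simp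
    qed
    finally show ?thesis by (simp add: \<beta>L)
  next
    case False
    have th: "theta m a 1 c N \<beta> = t powr (1 / a)"
      using False cond by (simp add: theta_def t_def L_def)
    have "lower_deviation N (t powr (1 / a))
        \<le> exp (- (real N * ((t powr (1 / a)) powr a / (4 * B * (4 * A) powr a))))"
      using False a N by (intro lower_deviation_powr ge_one_powr_ge_zero) auto
    also have "(t powr (1 / a)) powr a / (4 * B * (4 * A) powr a) = c * t"
      using a t by (simp add: powr_powr c_def)
    finally show ?thesis by (simp add: th tL \<beta>L)
  qed
  then show ?thesis by (simp add: c_def)
qed

end

section \<open>Quadratic forms and the theorem\<close>

lemma
  fixes y :: "real ^ 'n" and M :: "real ^ 'n ^ 'n"
  defines "W \<equiv> (\<chi> i. y $ i *\<^sub>R y) :: real ^ 'n ^ 'n"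
  shows quadratic_form_eq_inner: "y \<bullet> (M *v y) = M \<bullet> W"
    and norm_outer_square: "norm W = (norm y)\<^sup>2"
proof -
  show "y \<bullet> (M *v y) = M \<bullet> W"
    by (simp add: W_def inner_vec_def matrix_vector_mult_def sum_distrib_left mult_ac)
  have "norm W = L2_set (\<lambda>i. norm y * \<bar>y $ i\<bar>) UNIV"
    by (simp add: W_def norm_vec_def[where 'a = "real ^ 'n"] mult.commute)
  also have "\<dots> = norm y * norm y"
    by (simp add: L2_set_right_distrib[symmetric] norm_vec_def[of y])
  finally show "norm W = (norm y)\<^sup>2" by (simp add: power2_eq_square)
qed

theorem theorem4p4:
  fixes a A :: real and m :: nat
  assumes a: "a > 1" and m: "m = CARD('n::finite) * (CARD('n) + 1) div 2"
  shows "\<exists>c\<^sub>1 c\<^sub>2 :: real. c\<^sub>1 > 0 \<and> c\<^sub>2 > 0 \<and>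
    (\<forall>(P :: (real ^ 'n ^ 'n) measure) (p :: real) (N :: nat) (\<beta> :: real) (y :: real ^ 'n).
       prob_space P \<longrightarrow>
       sets P = sets sym_borel \<longrightarrow>
       integrable P (\<lambda>Q. exp (norm Q powr a)) \<longrightarrow>
       (\<integral>Q. exp (norm Q powr a) \<partial>P) = A \<longrightarrow>
       p \<ge> 1 \<longrightarrow> N \<ge> 1 \<longrightarrow> 0 < \<beta> \<longrightarrow> \<beta> < 1 \<longrightarrow> y \<in> sphere 0 1 \<longrightarrow>
       measure (PiM {..<N} (\<lambda>_. P))
         {Q \<in> space (PiM {..<N} (\<lambda>_. P)).
            y \<bullet> (((\<integral>X. X \<partial>P) - (\<integral>X. X \<partial>empirical_measure N Q)) *v y) \<le> theta m a c\<^sub>1 c\<^sub>2 N \<beta>}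
         \<ge> 1 - \<beta>)"
proof -
  \<comment> \<open>For \<open>A \<le> 0\<close> no distribution has moment \<open>A\<close>, but a positive constant is still due.\<close>
  define c where "c = (if A > 0 then 1 / (4 * mgf_const a A * (4 * A) powr a) else 1)"
  have "c > 0" by (simp add: c_def mgf_const_def)
  moreover have "measure (PiM {..<N} (\<lambda>_. P))
         {Q \<in> space (PiM {..<N} (\<lambda>_. P)).
            y \<bullet> (((\<integral>X. X \<partial>P) - (\<integral>X. X \<partial>empirical_measure N Q)) *v y) \<le> theta m a 1 c N \<beta>}
         \<ge> 1 - \<beta>" (is "measure ?M ?good \<ge> _")
    if P: "prob_space P" and sets: "sets P = sets sym_borel"
      and int: "integrable P (\<lambda>Q. exp (norm Q powr a))"
      and A: "(\<integral>Q. exp (norm Q powr a) \<partial>P) = A"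
      and N: "N \<ge> 1" and \<beta>: "0 < \<beta>" "\<beta> < 1" and y: "y \<in> sphere 0 1"
    for P :: "(real ^ 'n ^ 'n) measure" and N \<beta> y
  proof -
    interpret P: prob_space P by fact
    interpret PP: prob_space ?M by (intro prob_space_PiM P)
    define W where "W = ((\<chi> i. y $ i *\<^sub>R y) :: real ^ 'n ^ 'n)"
    define f where "f X = X \<bullet> W" for X
    let ?\<theta> = "theta m a 1 c N \<beta>"
    have W: "norm W = 1" using y by (simp add: W_def norm_outer_square)
    have space: "space P = sym_mats"
      using sets_eq_imp_space_eq[OF sets] by (simp add: space_sym_borel)
    have id_meas [measurable]: "(\<lambda>X. X) \<in> borel_measurable P"
      unfolding measurable_cong_sets[OF sets refl] sym_borel_def
      by (intro measurable_restrict_space1) simp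
    have int_id: "integrable P (\<lambda>X. X)"
      by (rule Bochner_Integration.integrable_bound[OF int])
        (use le_exp_powr[OF a norm_ge_zero] in auto)
    have f_le: "\<bar>f X\<bar> \<le> norm X" for X
      using Cauchy_Schwarz_ineq2[of X W] by (simp add: f_def W)
    have pt: "exp (\<bar>f X\<bar> powr a) \<le> exp (norm X powr a)" for X
      using f_le a by (auto intro!: powr_mono2)
    have f_meas: "f \<in> borel_measurable P" unfolding f_def by measurable
    have f_int: "integrable P (\<lambda>X. exp (\<bar>f X\<bar> powr a))"
      by (rule Bochner_Integration.integrable_bound[OF int]) (use pt f_meas in auto)
    have "(\<integral>X. exp (\<bar>f X\<bar> powr a) \<partial>P) \<le> A"
      unfolding A[symmetric] by (intro integral_mono f_int int pt)
    then interpret weibull_tail P f a A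
      using a f_meas f_int by unfold_locales auto
    have c_eq: "c = 1 / (4 * mgf_const a A * (4 * A) powr a)"
      using A_ge_1 by (simp add: c_def)
    let ?bad = "{Q \<in> space ?M. (\<Sum>i<N. P.expectation f - f (Q i)) \<ge> real N * ?\<theta>}"
    have dev: "y \<bullet> (((\<integral>X. X \<partial>P) - (\<integral>X. X \<partial>empirical_measure N Q)) *v y)
        = (\<Sum>i<N. P.expectation f - f (Q i)) / real N" if Q: "Q \<in> space ?M" for Q
    proof -
      have "Q i \<in> sym_mats" if "i < N" for i
        using Q that by (auto simp: space_PiM space PiE_iff)
      then have "(\<integral>X. X \<partial>empirical_measure N Q) = (1 / real N) *\<^sub>R (\<Sum>i<N. Q i)"
        by (rule expectation_empirical_measure)
      moreover have "P.expectation f = (\<integral>X. X \<partial>P) \<bullet> W"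
        unfolding f_def by (rule integral_inner_left) (rule int_id)
      ultimately show ?thesis
        using N by (simp add: quadratic_form_eq_inner f_def W_def[symmetric] inner_diff_left
            inner_sum_left sum_subtractf diff_divide_distrib)
    qed
    have "space ?M - ?bad \<subseteq> ?good"
      using N by (auto simp: dev divide_le_eq mult.commute)
    moreover have good_eq: "?good = {Q \<in> space ?M. (\<Sum>i<N. P.expectation f - f (Q i)) / real N \<le> ?\<theta>}"
      using dev by auto
    moreover have "?good \<in> sets ?M"
      unfolding good_eq using f_meas by measurable
    ultimately have "measure ?M (space ?M - ?bad) \<le> measure ?M ?good"
      by (intro PP.finite_measure_mono) auto
    moreover have "measure ?M (space ?M - ?bad) = 1 - lower_deviation N ?\<theta>"
      unfolding lower_deviation_def using f_meas by (intro PP.prob_compl) measurable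
    moreover have "lower_deviation N ?\<theta> \<le> \<beta>"
      unfolding c_eq by (rule lower_deviation_theta[OF N \<beta>])
    ultimately show ?thesis by linarith
  qed
  ultimately show ?thesis
    by (intro exI[of _ "1::real"] exI[of _ c]) auto
qed

end
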